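(* Let $p$ be a prime and let $a_2,a_3,b_2,b_3$ be nonzero elements of the field $\mathbb{Q}_p$ of $p$-adic numbers. Let $\xi_1,\xi_2,\xi_3,\xi_4$ be independent $\mathbb{Q}_p$-valued random variables with nowhere-vanishing characteristic functions, and put $L_1=\xi_1+a_2\xi_2+a_3\xi_3$, $L_2=b_2\xi_2+b_3\xi_3+\xi_4$. For independent $\mathbb{Q}_p$-valued random variables $\eta_1,\dots,\eta_4$ with nowhere-vanishing characteristic functions put $M_1=\eta_1+a_2\eta_2+a_3\eta_3$, $M_2=b_2\eta_2+b_3\eta_3+\eta_4$. (I) If $a_2b_3\neq a_3b_2$, then for every such $\eta_1,\dots,\eta_4$ with $(M_1,M_2)$ equal in distribution to $(L_1,L_2)$, there exist $\alpha_1,\dots,\alpha_4\in\mathbb{Q}_p$ such that $\eta_j$ has the same distribution as $\xi_j+\alpha_j$ for $j=1,2,3,4$. (II) If $a_2b_3=a_3b_2$, $|a_2|_p\neq|a_3|_p$, and $\xi_2,\xi_3$ are identically distributed, then for every such $\eta_1,\dots,\eta_4$ with $\eta_2,\eta_3$ identically distributed and $(M_1,M_2)$ equal in distribution to $(L_1,L_2)$, there exist $\alpha_1,\dots,\alpha_4\in\mathbb{Q}_p$ such that $\eta_j$ has the same distribution as $\xi_j+\alpha_j$ for $j=1,2,3,4$.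
   Context: $|\cdot|_p$ denotes the $p$-adic norm on $\mathbb{Q}_p$. The additive group of $\mathbb{Q}_p$ is a locally compact Abelian group whose character group is topologically isomorphic to $\mathbb{Q}_p$; write $(x,y)$ for the value of the character $y$ at $x$, with $(ax,y)=(x,ay)$ for $a,x,y\in\mathbb{Q}_p$. The characteristic function of a $\mathbb{Q}_p$-valued random variable $\xi$ with distribution $\mu$ is $\hat\mu(y)=\mathbf{E}[(\xi,y)]=\int_{\mathbb{Q}_p}(x,y)\,d\mu(x)$, $y$ in the character group; "nowhere-vanishing" means $\hat\mu(y)\neq0$ for all $y$. *)

theory Defs
  imports "HOL-Probability.Probability" "HOL-Computational_Algebra.Factorial_Ring"
begin

definition padic_abs_rat :: "nat \<Rightarrow> rat \<Rightarrow> real" where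
  "padic_abs_rat p q =
     (if q = 0 then 0
      else (case quotient_of q of (a, b) \<Rightarrow>
              real p powr (real (multiplicity (int p) b) - real (multiplicity (int p) a))))"

text \<open>Characterisation of the p-adic field: a field of characteristic 0 carrying a metric
  induced by an absolute value N which extends the p-adic absolute value of the rationals,
  which is complete, and in which the rationals are dense.  Any such structure is
  isometrically isomorphic (as a valued field, hence as a topological field) to Q_p,
  i.e. it is the completion of Q with respect to the p-adic absolute value.\<close>
definition Qp_model :: "nat \<Rightarrow> ('a::{field_char_0, metric_space} \<Rightarrow> real) \<Rightarrow> bool" where
  "Qp_model p N \<longleftrightarrow>
     (\<forall>x y. dist x y = N (x - y)) \<and>
     (\<forall>x. N x = 0 \<longleftrightarrow> x = 0) \<and>
     (\<forall>x y. N (x * y) = N x * N y) \<and>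
     (\<forall>x y. N (x + y) \<le> max (N x) (N y)) \<and>
     (\<forall>q. N (of_rat q) = padic_abs_rat p q) \<and>
     Topological_Spaces.complete (UNIV :: 'a set) \<and>
     closure (range (of_rat :: rat \<Rightarrow> 'a)) = UNIV"

definition is_character :: "('a::{ab_group_add, topological_space} \<Rightarrow> complex) \<Rightarrow> bool" where
  "is_character chr \<longleftrightarrow> continuous_on UNIV chr \<and>
     (\<forall>x y. chr (x + y) = chr x * chr y) \<and> (\<forall>x. cmod (chr x) = 1)"

definition nowhere_vanishing_cf ::
    "'w measure \<Rightarrow> ('w \<Rightarrow> 'a::{ab_group_add, topological_space}) \<Rightarrow> bool" where
  "nowhere_vanishing_cf M X \<longleftrightarrow>
     (\<forall>chr. is_character chr \<longrightarrow> (\<integral>\<omega>. chr (X \<omega>) \<partial>M) \<noteq> 0)"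

end

(*
Writing f_j for the quotient of the characteristic functions of eta_j and xi_j, equality of the joint
laws says f_1(u) f_2(a_2 u + b_2 v) f_3(a_3 u + b_3 v) f_4(v) = 1.

(I) If the four linear forms are pairwise independent, each f_j has trivial third multiplicative
differences, so B(y, z) = f_j(y + z) / (f_j(y) f_j(z)) is biadditive.  As f_j(-y) is the conjugate of
f_j(y), B(y, y) = |f_j(y)|^2, whence |f_j(n y)| = |f_j(y)|^(n^2).  Every element is brought close to 0
by a power of p, where |f_j| is bounded along all multiples n y; hence |f_j| = 1 and B is alternating
as well as symmetric, thus B^2 = 1, and B = 1 by divisibility by 2.

(II) With t = a_3 / a_2 and f = f_2 = f_3 the equation makes f(y) f(t y) multiplicative, so that
h(y, z) = f(y + z) / (f(y) f(z)) satisfies h(y, z) = h(t^2 y, t^2 z).  Iterating t or 1/t, whichever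
is contracting, gives h = 1.

In both cases f_j is a continuous character, hence y |-> psi(alpha_j y) for the standard character psi
by self-duality of Q_p, and uniqueness of characteristic functions identifies eta_j with xi_j + alpha_j
in law.
*)

theory Submission
  imports Defs
begin

section \<open>The standard character of the p-adic numbers\<close>

locale padic_field =
  fixes p :: nat and N :: "'a::{field_char_0, metric_space} \<Rightarrow> real"
  assumes p: "prime p" and model: "Qp_model p N"
begin

section \<open>Elementary properties of the ultrametric absolute value\<close>

lemma dist_eq: "dist x y = N (x - y)"
  using model by (auto simp: Qp_model_def)

lemma N_eq_0_iff [simp]: "N x = 0 \<longleftrightarrow> x = 0"
  using model by (auto simp: Qp_model_def)

lemma N_mult: "N (x * y) = N x * N y"
  using model by (auto simp: Qp_model_def)

lemma N_add: "N (x + y) \<le> max (N x) (N y)"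
  using model by (auto simp: Qp_model_def)

lemma N_of_rat: "N (of_rat q) = padic_abs_rat p q"
  using model by (auto simp: Qp_model_def)

lemma N_nonneg [simp]: "N x \<ge> 0"
  using dist_eq[of x 0] zero_le_dist[of x 0] by simp

lemma N_0 [simp]: "N 0 = 0"
  using N_eq_0_iff[of 0] by blast

lemma N_1 [simp]: "N 1 = 1"
  using N_mult[of 1 1] by simp

lemma N_minus [simp]: "N (- x) = N x"
  using dist_eq[of x 0] dist_eq[of 0 x] by (simp add: dist_commute)

lemma N_minus_commute: "N (x - y) = N (y - x)"
  using N_minus[of "x - y"] by simp

lemma N_diff: "N (x - y) \<le> max (N x) (N y)"
  using N_add[of x "- y"] by simp

lemma N_power: "N (x ^ n) = N x ^ n"
  by (induction n) (simp_all add: N_mult)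

lemma N_divide: "N (x / y) = N x / N y"
proof (cases "y = 0")
  case False
  then show ?thesis using N_mult[of "x / y" y] by (simp add: field_simps)
qed auto

lemma p_gt_1: "p > 1"
  using p prime_gt_1_nat by blast

lemma N_of_int: "c \<noteq> 0 \<Longrightarrow> N (of_int c) = 1 / real p ^ multiplicity (int p) c"
  using N_of_rat[of "of_int c"] p_gt_1
  by (simp add: padic_abs_rat_def powr_minus powr_realpow field_simps)

lemma N_of_int_le_1: "N (of_int c) \<le> 1"
  using p_gt_1 by (cases "c = 0") (auto simp: N_of_int)

lemma N_of_nat_le_1: "N (of_nat n) \<le> 1"
  using N_of_int_le_1[of "int n"] by simp

lemma N_p: "N (of_nat p) = 1 / real p"
proof -
  have "multiplicity (int p) (int p) = 1"
    using p by (intro multiplicity_self) (auto simp: not_prime_unit)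
  then show ?thesis using N_of_int[of "int p"] p_gt_1 by simp
qed

lemma of_nat_p_neq_0 [simp]: "of_nat p \<noteq> (0 :: 'b :: semiring_char_0)"
  using p_gt_1 by simp

lemma N_of_int_le_iff: "N (of_int c) \<le> 1 / real p ^ n \<longleftrightarrow> int p ^ n dvd c"
proof (cases "c = 0")
  case False
  have "N (of_int c) \<le> 1 / real p ^ n \<longleftrightarrow> real p ^ n \<le> real p ^ multiplicity (int p) c"
    using p_gt_1 by (simp add: N_of_int[OF False] field_simps)
  also have "\<dots> \<longleftrightarrow> n \<le> multiplicity (int p) c"
    using p_gt_1 by simp
  also have "\<dots> \<longleftrightarrow> int p ^ n dvd c"
    using False p by (intro power_dvd_iff_le_multiplicity[symmetric]) (auto simp: not_prime_unit)
  finally show ?thesis .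
qed auto

section \<open>The ring Z[1/p] as a source of representatives modulo the unit ball\<close>

definition pfrac :: "rat set" where
  "pfrac = {of_int c / of_nat p ^ k | c k. True}"

lemma pfrac_add: "r \<in> pfrac \<Longrightarrow> s \<in> pfrac \<Longrightarrow> r + s \<in> pfrac"
proof -
  assume "r \<in> pfrac" "s \<in> pfrac"
  then obtain c k d l where "r = of_int c / of_nat p ^ k" "s = of_int d / of_nat p ^ l"
    by (auto simp: pfrac_def)
  then have "r + s = of_int (c * int p ^ l + d * int p ^ k) / of_nat p ^ (k + l)"
    using p_gt_1 by (simp add: add_divide_distrib power_add)
  then show ?thesis unfolding pfrac_def by blast
qed

lemma pfrac_minus: "r \<in> pfrac \<Longrightarrow> - r \<in> pfrac"
  unfolding pfrac_def by clarify (metis minus_divide_left of_int_minus)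

lemma pfrac_diff: "r \<in> pfrac \<Longrightarrow> s \<in> pfrac \<Longrightarrow> r - s \<in> pfrac"
  using pfrac_add[OF _ pfrac_minus] by fastforce

text \<open>If \<open>N\<close> of c / p^k is at most 1, then p^k divides c. This is what makes
  \<open>psi\<close> independent of the representative chosen in its definition.\<close>

lemma pfrac_Ints_iff: "r \<in> pfrac \<Longrightarrow> N (of_rat r) \<le> 1 \<longleftrightarrow> r \<in> \<int>"
proof
  assume "r \<in> pfrac" "N (of_rat r) \<le> 1"
  then obtain c k where r: "r = of_int c / of_nat p ^ k"
    by (auto simp: pfrac_def)
  have "N (of_int c) \<le> 1 / real p ^ k"
    using \<open>N (of_rat r) \<le> 1\<close> p_gt_1
    by (simp add: r of_rat_divide of_rat_power N_divide N_power N_p field_simps)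
  then have "int p ^ k dvd c" by (simp add: N_of_int_le_iff)
  then obtain d where "c = int p ^ k * d" by auto
  then have "r = of_int d" using p_gt_1 by (simp add: r)
  then show "r \<in> \<int>" by simp
next
  assume "r \<in> \<int>"
  then show "N (of_rat r) \<le> 1" by (auto elim!: Ints_cases simp: N_of_int_le_1)
qed

lemma rat_dense:
  assumes "e > 0" shows "\<exists>q. N (x - of_rat q) < e"
proof -
  have "x \<in> closure (range (of_rat :: rat \<Rightarrow> 'a))"
    using model by (simp add: Qp_model_def)
  then obtain q where "dist (of_rat q) x < e"
    using assms unfolding closure_approachable by auto
  then show ?thesis by (auto simp: dist_eq N_minus_commute)
qed

text \<open>Partial fractions: a denominator p^k * b with b prime to p splits q into a term with
  denominator p^k and a term with denominator b, and the latter is a p-adic integer.\<close>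

lemma pfrac_approx_rat: "\<exists>r\<in>pfrac. N (of_rat q - of_rat r) \<le> 1"
proof -
  obtain a d where q: "q = of_int a / of_int d" and "d > 0"
    by (metis Fract_of_int_quotient Rat_cases)
  then have d: "d \<noteq> 0" by simp
  moreover have "\<not> is_unit (int p)" using p by (auto simp: not_prime_unit)
  ultimately obtain b where b: "d = int p ^ multiplicity (int p) d * b" "\<not> int p dvd b"
    using multiplicity_decompose'[of d "int p"] by (metis mult.commute)
  define k where "k = multiplicity (int p) d"
  have d_eq: "d = int p ^ k * b" using b(1) by (simp add: k_def)
  have "coprime (int p) b"
    using b(2) p by (intro prime_imp_coprime) auto
  then have "coprime b (int p ^ k)"
    by (simp add: coprime_commute)
  \<comment> \<open>Bezout's identity, multiplied by \<open>a\<close>, supplies the numerators of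
    the two partial fractions.\<close>
  then obtain c v where cv: "c * b + v * int p ^ k = 1"
    using bezout_int[of b "int p ^ k"] by auto
  define e where "e = v * a"
  have "a = a * (c * b + v * int p ^ k)" by (simp add: cv)
  then have a: "a = b * (c * a) + int p ^ k * e" by (simp add: e_def algebra_simps)
  have [simp]: "b \<noteq> 0" using d_eq d by auto
  have "q = (of_int b * of_int (c * a) + of_nat p ^ k * of_int e) / (of_nat p ^ k * of_int b)"
    unfolding q d_eq by (subst a) simp
  also have "\<dots> = of_int (c * a) / of_nat p ^ k + of_int e / of_int b"
    using p_gt_1 by (simp add: add_divide_distrib)
  finally have "of_rat q - of_rat (of_int (c * a) / of_nat p ^ k) = (of_int e / of_int b :: 'a)"
    by (simp add: of_rat_add of_rat_divide)
  moreover have "N (of_int b) = 1"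
    using b(2) by (simp add: N_of_int not_dvd_imp_multiplicity_0)
  ultimately have "N (of_rat q - of_rat (of_int (c * a) / of_nat p ^ k)) \<le> 1"
    by (simp add: N_divide N_of_int_le_1)
  then show ?thesis unfolding pfrac_def by blast
qed

lemma pfrac_approx: "\<exists>r\<in>pfrac. N (x - of_rat r) \<le> 1"
proof -
  obtain q where q: "N (x - of_rat q) < 1" using rat_dense[of 1 x] by auto
  obtain r where r: "r \<in> pfrac" "N (of_rat q - of_rat r) \<le> 1" using pfrac_approx_rat by blast
  have "N (x - of_rat r) \<le> max (N (x - of_rat q)) (N (of_rat q - of_rat r))"
    using N_add[of "x - of_rat q" "of_rat q - of_rat r"] by simp
  then show ?thesis using q r by force
qed

text \<open>This is x |-> exp(2 pi i {x}) with {x} the p-adic fractional part. Any representative of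
  x in Z[1/p] may serve for {x}, since two of them differ by an integer; hence a choice operator
  instead of digit expansions.\<close>

definition psi :: "'a \<Rightarrow> complex" where
  "psi x = cis (2 * pi * of_rat (SOME r. r \<in> pfrac \<and> N (x - of_rat r) \<le> 1))"

lemma cis_2pi_eq_1_iff: "cis (2 * pi * of_rat r) = 1 \<longleftrightarrow> r \<in> \<int>"
proof
  assume "cis (2 * pi * of_rat r) = 1"
  then have "cos (2 * pi * of_rat r) = 1" by (simp add: complex_eq_iff)
  then obtain n :: int where "2 * pi * real_of_rat r = real_of_int n * 2 * pi"
    using cos_one_2pi_int by auto
  then have "real_of_rat r = of_rat (of_int n)" by simp
  then have "r = of_int n" by (simp only: of_rat_eq_iff)
  then show "r \<in> \<int>" by simp
next
  assume "r \<in> \<int>"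
  then show "cis (2 * pi * of_rat r) = 1"
    by (auto elim!: Ints_cases simp: cis_multiple_2pi)
qed

lemma cis_of_rat_add:
  "cis (2 * pi * of_rat (r + s)) = cis (2 * pi * of_rat r) * cis (2 * pi * of_rat s)"
  by (simp add: of_rat_add cis_mult distrib_left)

lemma psi_eq:
  assumes r: "r \<in> pfrac" "N (x - of_rat r) \<le> 1"
  shows "psi x = cis (2 * pi * of_rat r)"
proof -
  define s where "s = (SOME r. r \<in> pfrac \<and> N (x - of_rat r) \<le> 1)"
  have s: "s \<in> pfrac" "N (x - of_rat s) \<le> 1"
    using someI_ex[of "\<lambda>r. r \<in> pfrac \<and> N (x - of_rat r) \<le> 1"] pfrac_approx[of x]
    unfolding s_def by blast+
  have "N (of_rat (s - r)) \<le> 1"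
    using N_diff[of "x - of_rat r" "x - of_rat s"] r s by (auto simp: of_rat_diff)
  then have "cis (2 * pi * of_rat (s - r)) = 1"
    using pfrac_Ints_iff[OF pfrac_diff[OF s(1) r(1)]] cis_2pi_eq_1_iff by blast
  then have "cis (2 * pi * of_rat s) = cis (2 * pi * of_rat r)"
    using cis_of_rat_add[of r "s - r"] by simp
  then show ?thesis by (simp add: psi_def s_def)
qed

lemma psi_add: "psi (x + y) = psi x * psi y"
proof -
  obtain r s where rs: "r \<in> pfrac" "N (x - of_rat r) \<le> 1" "s \<in> pfrac" "N (y - of_rat s) \<le> 1"
    using pfrac_approx by blast
  have "N (x + y - of_rat (r + s)) \<le> 1"
    using N_add[of "x - of_rat r" "y - of_rat s"] rs by (auto simp: of_rat_add algebra_simps)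
  then show ?thesis
    using psi_eq[OF rs(1,2)] psi_eq[OF rs(3,4)] psi_eq[OF pfrac_add[OF rs(1,3)]] cis_of_rat_add
    by simp
qed

text \<open>A representative of x in Z[1/p] is an integer exactly when it lies in the unit ball,
  that is, when x does. Knowing the kernel exactly lets \<open>psi\<close> detect balls later
  on.\<close>

lemma psi_eq_1_iff: "psi x = 1 \<longleftrightarrow> N x \<le> 1"
proof -
  obtain r where r: "r \<in> pfrac" "N (x - of_rat r) \<le> 1" using pfrac_approx by blast
  have "psi x = 1 \<longleftrightarrow> N (of_rat r) \<le> 1"
    using psi_eq[OF r] cis_2pi_eq_1_iff pfrac_Ints_iff[OF r(1)] by simp
  also have "\<dots> \<longleftrightarrow> N x \<le> 1"
    using r(2) N_diff[of x "x - of_rat r"] N_add[of "x - of_rat r" "of_rat r"] by auto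
  finally show ?thesis .
qed

lemma cmod_psi [simp]: "cmod (psi x) = 1"
  by (simp add: psi_def)

lemma psi_0 [simp]: "psi 0 = 1"
  by (simp add: psi_eq_1_iff)

lemma psi_minus: "psi (- x) = cnj (psi x)"
proof -
  have "psi x * psi (- x) = psi x * cnj (psi x)"
    using psi_add[of x "- x"] by (simp add: complex_norm_square[symmetric])
  then show ?thesis using cmod_psi[of x] by (metis mult_cancel_left norm_zero zero_neq_one)
qed

lemma is_character_psi: "is_character (\<lambda>x. psi (y * x))"
proof -
  have "continuous_on UNIV (\<lambda>x. psi (y * x))"
  proof (subst continuous_on_iff, intro ballI allI impI)
    fix x :: 'a and e :: real assume "e > 0"
    \<comment> \<open>The character is locally constant, since y * (x' - x) falls into the kernel of
      \<open>psi\<close>. The summand 1 keeps the radius positive for y = 0.\<close>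
    have "psi (y * x') = psi (y * x)" if "dist x' x < 1 / (N y + 1)" for x'
    proof -
      have "N y * N (x' - x) \<le> (N y + 1) * N (x' - x)"
        by (simp add: mult_right_mono)
      also have "\<dots> \<le> 1" using that by (simp add: dist_eq pos_less_divide_eq add_nonneg_pos mult.commute)
      finally have "psi (y * (x' - x)) = 1" by (simp add: psi_eq_1_iff N_mult)
      then show ?thesis using psi_add[of "y * (x' - x)" "y * x"] by (simp add: algebra_simps)
    qed
    moreover have "1 / (N y + 1) > 0" by (simp add: add_nonneg_pos)
    ultimately show "\<exists>d>0. \<forall>x'\<in>UNIV. dist x' x < d \<longrightarrow> dist (psi (y * x')) (psi (y * x)) < e"
      using \<open>e > 0\<close> by (metis dist_self)
  qed
  then show ?thesis by (simp add: is_character_def psi_add distrib_left)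
qed

lemma psi_measurable [measurable]: "(\<lambda>x. psi (y * x)) \<in> borel_measurable borel"
  using is_character_psi by (intro borel_measurable_continuous_onI) (auto simp: is_character_def)

end

section \<open>Uniqueness of characteristic functions\<close>

text \<open>For w different from 1 the geometric sum stays bounded by 2 / |w - 1|, so dividing by n
  + 1 sends it to 0. The limit turns powers of a character value into an indicator.\<close>

lemma power_averages_tendsto:
  fixes w :: complex
  assumes "cmod w = 1"
  shows "(\<lambda>n. (\<Sum>j<Suc n. w ^ j) / of_nat (Suc n)) \<longlonglongrightarrow> (if w = 1 then 1 else 0)"
proof (cases "w = 1")
  case True
  have "(\<Sum>j<Suc n. w ^ j) / of_nat (Suc n) = 1" for n
    using True by (simp del: of_nat_Suc)
  then show ?thesis using True by simp
next
  case False
  have "cmod ((\<Sum>j<Suc n. w ^ j) / of_nat (Suc n)) \<le> (2 / cmod (w - 1)) * inverse (real (Suc n))" for n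
  proof -
    have "(\<Sum>j<Suc n. w ^ j) = (w ^ Suc n - 1) / (w - 1)"
      using False by (rule geometric_sum)
    moreover have "cmod (w ^ Suc n - 1) \<le> 2"
      using norm_triangle_ineq4[of "w ^ Suc n" 1] assms by (simp add: norm_power norm_mult)
    ultimately have "cmod (\<Sum>j<Suc n. w ^ j) \<le> 2 / cmod (w - 1)"
      by (simp add: norm_divide divide_right_mono)
    then have "cmod (\<Sum>j<Suc n. w ^ j) * inverse (real (Suc n)) \<le> 2 / cmod (w - 1) * inverse (real (Suc n))"
      by (rule mult_right_mono) simp
    then show ?thesis
      by (simp only: divide_inverse norm_mult norm_inverse norm_of_nat)
  qed
  moreover have "(\<lambda>n. (2 / cmod (w - 1)) * inverse (real (Suc n))) \<longlonglongrightarrow> 0"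
    using tendsto_mult_right_zero[OF LIMSEQ_inverse_real_of_nat] by blast
  ultimately have "(\<lambda>n. (\<Sum>j<Suc n. w ^ j) / of_nat (Suc n)) \<longlonglongrightarrow> 0"
    by (rule Lim_null_comparison[OF always_eventually[OF allI]])
  then show ?thesis using False by simp
qed

text \<open>The circle has no small subgroups: for w different from 1 the averages of the powers
  would tend to 0, yet they stay within 1/2 of 1.\<close>

lemma unimodular_eq_1_if_powers_near_1:
  fixes w :: complex
  assumes "cmod w = 1" and "\<And>n. cmod (w ^ n - 1) \<le> 1 / 2"
  shows "w = 1"
proof (rule ccontr)
  assume "w \<noteq> 1"
  define A where "A n = (\<Sum>j<Suc n. w ^ j) / of_nat (Suc n)" for n
  have "cmod (A n - 1) \<le> 1 / 2" for n
  proof -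
    have "A n - 1 = (\<Sum>j<Suc n. w ^ j - 1) / of_nat (Suc n)"
      by (simp add: A_def sum_subtractf diff_divide_distrib del: of_nat_Suc sum.lessThan_Suc)
    moreover have "cmod (\<Sum>j<Suc n. w ^ j - 1) \<le> of_nat (card {..<Suc n}) * (1 / 2)"
      using assms(2) by (intro sum_norm_bound) auto
    ultimately show ?thesis
      by (simp add: norm_divide pos_divide_le_eq del: of_nat_Suc sum.lessThan_Suc)
  qed
  moreover have "(\<lambda>n. cmod (A n - 1)) \<longlonglongrightarrow> cmod (0 - 1)"
    using power_averages_tendsto[OF assms(1)] \<open>w \<noteq> 1\<close> unfolding A_def
    by (intro tendsto_intros) auto
  ultimately have "cmod (0 - 1) \<le> 1 / 2"
    by (intro LIMSEQ_le_const2) auto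
  then show False by simp
qed

context padic_field
begin

text \<open>Balls are indexed by the reciprocal \<^term>\<open>y\<close> of the radius; \<^term>\<open>y = 0\<close> gives the whole field.\<close>

definition padic_ball :: "'a \<Rightarrow> 'a \<Rightarrow> 'a set" where
  "padic_ball a y = {x. N ((x - a) * y) \<le> 1}"

text \<open>The empty set is included to make the family closed under intersection.\<close>

definition padic_balls :: "'a set set" where
  "padic_balls = insert {} {padic_ball a y | a y. True}"

lemma padic_ball_recenter:
  assumes "b \<in> padic_ball a y" shows "padic_ball a y = padic_ball b y"
proof -
  have *: "N ((x - b) * y) \<le> 1" if "N ((x - a) * y) \<le> 1" "N ((b - a) * y) \<le> 1" for x a b
    using N_diff[of "(x - a) * y" "(b - a) * y"] that by (auto simp: algebra_simps)
  have "N ((a - b) * y) = N ((b - a) * y)"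
    using N_minus_commute[of a b] by (simp add: N_mult)
  then show ?thesis using assms *[of _ a b] *[of _ b a] by (auto simp: padic_ball_def)
qed

text \<open>Balls with a common point can both be recentred there, and concentric balls are
  nested.\<close>

lemma Int_stable_padic_balls: "Int_stable padic_balls"
proof (rule Int_stableI)
  fix U V assume "U \<in> padic_balls" "V \<in> padic_balls"
  show "U \<inter> V \<in> padic_balls"
  proof (cases "U \<inter> V = {}")
    case False
    then obtain c where c: "c \<in> U" "c \<in> V" by auto
    with \<open>U \<in> padic_balls\<close> \<open>V \<in> padic_balls\<close> obtain y z where
      UV: "U = padic_ball c y" "V = padic_ball c z"
      unfolding padic_balls_def using padic_ball_recenter[of c] by blast
    have *: "padic_ball c z \<subseteq> padic_ball c y" if "N y \<le> N z" for y z
    proof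
      fix x assume "x \<in> padic_ball c z"
      then show "x \<in> padic_ball c y"
        using mult_left_mono[OF that, of "N (x - c)"] by (auto simp: padic_ball_def N_mult)
    qed
    have "U \<inter> V = U \<or> U \<inter> V = V"
      using *[of y z] *[of z y] UV by fastforce
    then show ?thesis using \<open>U \<in> padic_balls\<close> \<open>V \<in> padic_balls\<close> by auto
  qed (auto simp: padic_balls_def)
qed

lemma N_p_power_lt: "e > 0 \<Longrightarrow> \<exists>k. N (of_nat p ^ k) < e"
proof -
  assume "e > 0"
  moreover have "1 / real p < 1" using p_gt_1 by simp
  ultimately obtain k where "(1 / real p) ^ k < e"
    using real_arch_pow_inv by blast
  then show ?thesis by (auto simp: N_power N_p)
qed

lemma open_padic_ball: "open (padic_ball a y)"
proof (cases "y = 0")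
  case False
  show ?thesis unfolding open_dist
  proof (intro ballI exI[of _ "1 / N y"] conjI allI impI)
    fix x assume x: "x \<in> padic_ball a y"
    show "0 < 1 / N y" using False by (simp add: less_le)
    fix x' assume x': "dist x' x < 1 / N y"
    have "N y > 0" using False N_nonneg[of y] N_eq_0_iff[of y] by linarith
    then have "x' \<in> padic_ball x y"
      using x' by (simp add: padic_ball_def dist_eq N_mult pos_less_divide_eq)
    then show "x' \<in> padic_ball a y" using padic_ball_recenter[OF x] by simp
  qed
qed (simp add: padic_ball_def)

lemma rat_dense_scaled: "\<exists>q. N ((x - of_rat q) * y) \<le> 1"
proof -
  obtain q where q: "N (x - of_rat q) < 1 / (N y + 1)"
    using rat_dense[of "1 / (N y + 1)" x] by (auto simp: add_nonneg_pos)
  have "N (x - of_rat q) * N y \<le> N (x - of_rat q) * (N y + 1)"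
    by (intro mult_left_mono) auto
  also have "\<dots> \<le> 1" using q by (simp add: pos_less_divide_eq add_nonneg_pos)
  finally show ?thesis by (auto simp: N_mult)
qed

text \<open>By density of the rationals, an open set is the union of the balls inside it that have a
  rational centre and a radius p^-k, and these are countably many.\<close>

lemma sets_borel_padic: "sets (borel :: 'a measure) = sigma_sets UNIV padic_balls"
proof
  have "U \<in> sigma_sets UNIV padic_balls" if "open U" for U :: "'a set"
  proof -
    \<comment> \<open>The parameter 1 / p^k encodes the radius \<open>N\<close> (p^k) =
      p^-k.\<close>
    define I where "I = {(q, k). padic_ball (of_rat q) (1 / of_nat p ^ k) \<subseteq> U}"
    have "U \<subseteq> (\<Union>(q, k)\<in>I. padic_ball (of_rat q) (1 / of_nat p ^ k))"
    proof
      fix x assume "x \<in> U"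
      then obtain e where e: "e > 0" "\<And>x'. dist x' x < e \<Longrightarrow> x' \<in> U"
        using \<open>open U\<close> unfolding open_dist by blast
      obtain k where k: "N (of_nat p ^ k) < e" using N_p_power_lt e(1) by blast
      obtain q where "N ((x - of_rat q) * (1 / of_nat p ^ k)) \<le> 1" using rat_dense_scaled by blast
      then have x: "x \<in> padic_ball (of_rat q) (1 / of_nat p ^ k)" by (simp add: padic_ball_def)
      have "N (of_nat p ^ k) > 0" using p_gt_1 by (simp add: N_power N_p)
      then have "padic_ball x (1 / of_nat p ^ k) \<subseteq> U"
        using e(2) k by (auto simp: padic_ball_def dist_eq N_divide)
      then have "(q, k) \<in> I" using padic_ball_recenter[OF x] by (simp add: I_def)
      then show "x \<in> (\<Union>(q, k)\<in>I. padic_ball (of_rat q) (1 / of_nat p ^ k))" using x by blast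
    qed
    then have U: "U = (\<Union>(q, k)\<in>I. padic_ball (of_rat q) (1 / of_nat p ^ k))"
      unfolding I_def by blast
    show ?thesis
      by (subst U, rule sigma_sets_UNION)
        (auto simp: padic_balls_def intro!: sigma_sets.Basic)
  qed
  then have "sigma_sets UNIV {U. open U} \<subseteq> sigma_sets UNIV padic_balls"
    by (intro sigma_sets_mono) auto
  then show "sets (borel :: 'a measure) \<subseteq> sigma_sets UNIV padic_balls"
    by (simp add: borel_def)
  show "sigma_sets UNIV padic_balls \<subseteq> sets (borel :: 'a measure)"
    using sets.sigma_sets_subset[of padic_balls "borel :: 'a measure"] open_padic_ball
    by (force simp: padic_balls_def)
qed

section \<open>Measurability of sums and scalar multiples\<close>

lemma measurable_padicI:
  assumes "\<And>a y. {\<omega> \<in> space M. N ((X \<omega> - a) * y) \<le> 1} \<in> sets M"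
  shows "X \<in> borel_measurable M"
proof (rule measurable_sigma_sets[OF sets_borel_padic])
  fix B assume "B \<in> padic_balls"
  then consider "B = {}" | a y where "B = padic_ball a y" by (auto simp: padic_balls_def)
  then show "X -` B \<inter> space M \<in> sets M"
  proof cases
    case 2
    have "X -` B \<inter> space M = {\<omega> \<in> space M. N ((X \<omega> - a) * y) \<le> 1}"
      by (auto simp: 2 padic_ball_def)
    then show ?thesis using assms by simp
  qed auto
qed auto

lemma padic_ball_measurable:
  assumes "X \<in> borel_measurable M"
  shows "{\<omega> \<in> space M. N ((X \<omega> - a) * y) \<le> 1} \<in> sets M"
proof -
  have "X -` padic_ball a y \<inter> space M \<in> sets M"
    using assms by (rule measurable_sets) (simp add: open_padic_ball)
  moreover have "X -` padic_ball a y \<inter> space M = {\<omega> \<in> space M. N ((X \<omega> - a) * y) \<le> 1}"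
    by (auto simp: padic_ball_def)
  ultimately show ?thesis by simp
qed

text \<open>A sum lies in a ball about a iff, for some rational q, its terms lie in the balls of the
  same radius about q and a - q: density provides q, the ultrametric inequality the converse. So the
  preimage is a countable union of measurable sets.\<close>

lemma borel_measurable_padic_add:
  fixes X Y :: "'w \<Rightarrow> 'a"
  assumes X: "X \<in> borel_measurable M" and Y: "Y \<in> borel_measurable M"
  shows "(\<lambda>\<omega>. X \<omega> + Y \<omega>) \<in> borel_measurable M"
proof (rule measurable_padicI)
  fix a y
  have *: "N ((s + t - a) * y) \<le> 1 \<longleftrightarrow>
      (\<exists>q. N ((s - of_rat q) * y) \<le> 1 \<and> N ((t - (a - of_rat q)) * y) \<le> 1)" for s t
  proof
    assume st: "N ((s + t - a) * y) \<le> 1"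
    obtain q where q: "N ((s - of_rat q) * y) \<le> 1" using rat_dense_scaled by blast
    have "N ((t - (a - of_rat q)) * y) \<le> 1"
      using N_diff[of "(s + t - a) * y" "(s - of_rat q) * y"] st q by (auto simp: algebra_simps)
    then show "\<exists>q. N ((s - of_rat q) * y) \<le> 1 \<and> N ((t - (a - of_rat q)) * y) \<le> 1"
      using q by blast
  next
    assume "\<exists>q. N ((s - of_rat q) * y) \<le> 1 \<and> N ((t - (a - of_rat q)) * y) \<le> 1"
    then obtain q where "N ((s - of_rat q) * y) \<le> 1" "N ((t - (a - of_rat q)) * y) \<le> 1" by blast
    then show "N ((s + t - a) * y) \<le> 1"
      using N_add[of "(s - of_rat q) * y" "(t - (a - of_rat q)) * y"] by (auto simp: algebra_simps)
  qed
  have "{\<omega> \<in> space M. N ((X \<omega> + Y \<omega> - a) * y) \<le> 1} =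
      (\<Union>q. {\<omega> \<in> space M. N ((X \<omega> - of_rat q) * y) \<le> 1} \<inter>
           {\<omega> \<in> space M. N ((Y \<omega> - (a - of_rat q)) * y) \<le> 1})"
    unfolding * by blast
  also have "\<dots> \<in> sets M"
    using sets.Int[OF padic_ball_measurable[OF X] padic_ball_measurable[OF Y]]
    by (intro sets.countable_UN') auto
  finally show "{\<omega> \<in> space M. N ((X \<omega> + Y \<omega> - a) * y) \<le> 1} \<in> sets M" .
qed

lemma borel_measurable_padic_mult:
  fixes X :: "'w \<Rightarrow> 'a"
  assumes X: "X \<in> borel_measurable M" and "c \<noteq> 0"
  shows "(\<lambda>\<omega>. c * X \<omega>) \<in> borel_measurable M"
proof (rule measurable_padicI)
  fix a y
  have eq: "(c * X \<omega> - a) * y = (X \<omega> - a / c) * (c * y)" for \<omega>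
  proof -
    have "c * X \<omega> - a = (X \<omega> - a / c) * c"
      using \<open>c \<noteq> 0\<close> by (simp add: left_diff_distrib)
    then show ?thesis by (simp add: mult.assoc)
  qed
  show "{\<omega> \<in> space M. N ((c * X \<omega> - a) * y) \<le> 1} \<in> sets M"
    unfolding eq by (rule padic_ball_measurable[OF X])
qed

section \<open>Characteristic functions determine distributions\<close>

definition cf :: "'w measure \<Rightarrow> ('w \<Rightarrow> 'a) \<Rightarrow> 'a \<Rightarrow> complex" where
  "cf M X y = (\<integral>\<omega>. psi (y * X \<omega>) \<partial>M)"

lemma cf_distr: "X \<in> borel_measurable M \<Longrightarrow> cf (distr M borel X) (\<lambda>x. x) y = cf M X y"
  unfolding cf_def by (subst integral_distr) auto

lemma psi_power: "psi x ^ n = psi (of_nat n * x)"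
  by (induction n) (simp_all add: psi_add distrib_right)

text \<open>The averages of the powers of \<^term>\<open>psi ((x - a) * y)\<close> tend to the indicator of the ball, which
  therefore is a bounded pointwise limit of combinations of characters.\<close>

lemma measure_padic_ball_tendsto:
  assumes "prob_space \<mu>" and sets: "sets \<mu> = sets borel"
  shows "(\<lambda>n. (\<Sum>j<Suc n. psi (- (of_nat j * (a * y))) * cf \<mu> (\<lambda>x. x) (of_nat j * y)) / of_nat (Suc n))
    \<longlonglongrightarrow> measure \<mu> (padic_ball a y)"
proof -
  interpret prob_space \<mu> by fact
  have [measurable]: "(\<lambda>x. psi (y * x)) \<in> borel_measurable \<mu>" for y
    using psi_measurable sets measurable_cong_sets by blast
  have [simp]: "space \<mu> = UNIV" using sets sets_eq_imp_space_eq[of \<mu> borel] by simp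
  define S where "S n x = (\<Sum>j<Suc n. psi (- (of_nat j * (a * y))) * psi (of_nat j * y * x)) / of_nat (Suc n)"
    for n x
  have S_eq: "S n x = (\<Sum>j<Suc n. psi ((x - a) * y) ^ j) / of_nat (Suc n)" for n x
    unfolding S_def psi_power psi_add[symmetric]
    by (intro arg_cong2[where f = "(/)"] sum.cong arg_cong[where f = psi]) (simp_all add: algebra_simps)
  have int: "integrable \<mu> (\<lambda>x. psi (- (of_nat j * (a * y))) * psi (of_nat j * y * x))" for j
    by (rule integrable_const_bound[where B = 1]) (auto simp: norm_mult)
  have "(\<lambda>n. \<integral>x. S n x \<partial>\<mu>) \<longlonglongrightarrow> (\<integral>x. indicator (padic_ball a y) x \<partial>\<mu>)"
  proof (rule integral_dominated_convergence[where w = "\<lambda>_. 1"])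
    show "(indicator (padic_ball a y) :: _ \<Rightarrow> complex) \<in> borel_measurable \<mu>"
      using sets by (intro borel_measurable_indicator) (simp add: open_padic_ball)
    show "S n \<in> borel_measurable \<mu>" for n unfolding S_def by measurable
    show "AE x in \<mu>. (\<lambda>n. S n x) \<longlonglongrightarrow> indicator (padic_ball a y) x"
    proof (rule AE_I2)
      fix x
      show "(\<lambda>n. S n x) \<longlonglongrightarrow> indicator (padic_ball a y) x"
        using power_averages_tendsto[of "psi ((x - a) * y)"]
        unfolding S_eq psi_eq_1_iff by (simp only: cmod_psi indicator_def padic_ball_def mem_Collect_eq of_bool_def)
    qed
    show "AE x in \<mu>. cmod (S n x) \<le> 1" for n
    proof (rule AE_I2)
      fix x
      have "cmod (\<Sum>j<Suc n. psi ((x - a) * y) ^ j) \<le> of_nat (card {..<Suc n}) * 1"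
        by (intro sum_norm_bound) (simp add: norm_power)
      then show "cmod (S n x) \<le> 1"
        by (simp add: S_eq norm_divide field_simps del: of_nat_Suc sum.lessThan_Suc)
    qed
  qed simp
  moreover have "(\<integral>x. S n x \<partial>\<mu>) =
      (\<Sum>j<Suc n. psi (- (of_nat j * (a * y))) * cf \<mu> (\<lambda>x. x) (of_nat j * y)) / of_nat (Suc n)" for n
    unfolding S_def cf_def
    by (subst integral_divide_zero, subst Bochner_Integration.integral_sum)
      (auto simp: int simp del: sum.lessThan_Suc of_nat_Suc)
  moreover have "(\<integral>x. indicator (padic_ball a y) x \<partial>\<mu>) = complex_of_real (measure \<mu> (padic_ball a y))"
  proof -
    have "(\<integral>x. indicator (padic_ball a y) x \<partial>\<mu>) =
        (\<integral>x. complex_of_real (indicator (padic_ball a y) x) \<partial>\<mu>)"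
      by (intro Bochner_Integration.integral_cong) (auto simp: indicator_def)
    then show ?thesis by simp
  qed
  ultimately show ?thesis by simp
qed

text \<open>The mass of a ball is a limit of finite combinations of values of the characteristic
  function, and the balls form an intersection-stable generator of the Borel sets.\<close>

lemma cf_uniqueness:
  assumes \<mu>: "prob_space \<mu>" "sets \<mu> = sets borel" and \<nu>: "prob_space \<nu>" "sets \<nu> = sets borel"
    and eq: "\<And>y. cf \<mu> (\<lambda>x. x) y = cf \<nu> (\<lambda>x. x) y"
  shows "\<mu> = \<nu>"
proof (rule measure_eqI_generator_eq[OF Int_stable_padic_balls, where \<Omega> = UNIV and A = "\<lambda>_. UNIV"])
  interpret mu: prob_space \<mu> by fact
  interpret nu: prob_space \<nu> by fact
  fix B assume "B \<in> padic_balls"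
  then consider "B = {}" | a y where "B = padic_ball a y" by (auto simp: padic_balls_def)
  then show "emeasure \<mu> B = emeasure \<nu> B"
  proof cases
    case 2
    have "complex_of_real (measure \<mu> B) = complex_of_real (measure \<nu> B)"
      using measure_padic_ball_tendsto[OF \<mu>, of a y] measure_padic_ball_tendsto[OF \<nu>, of a y]
      unfolding eq 2 by (rule LIMSEQ_unique)
    then show ?thesis by (simp add: mu.emeasure_eq_measure nu.emeasure_eq_measure)
  qed auto
next
  have "UNIV = padic_ball 0 0" by (auto simp: padic_ball_def)
  then show "range (\<lambda>_. UNIV) \<subseteq> padic_balls" unfolding padic_balls_def by auto
  show "emeasure \<mu> UNIV \<noteq> \<infinity>"
    using prob_space.emeasure_space_1[OF \<mu>(1)] sets_eq_imp_space_eq[OF \<mu>(2)] by simp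
  show "sets \<mu> = sigma_sets UNIV padic_balls" "sets \<nu> = sigma_sets UNIV padic_balls"
    using \<mu> \<nu> sets_borel_padic by simp_all
qed simp_all

end

section \<open>Multiplicative functional equations and self-duality\<close>

text \<open>Shifting \<^term>\<open>(x, y)\<close> along the kernel of one of the linear forms leaves the corresponding factor
  unchanged, so three such shifts remove \<^term>\<open>G\<close>, \<^term>\<open>H\<close> and \<^term>\<open>K\<close>.\<close>

lemma third_difference_eq:
  fixes F G H K :: "'a :: field \<Rightarrow> 'b :: field"
  assumes eq: "\<And>x y. F x * G (c1 * x + d1 * y) * H (c2 * x + d2 * y) * K (c3 * x + d3 * y) = 1"
    and d: "d1 \<noteq> 0" "d2 \<noteq> 0" "d3 \<noteq> 0"
  shows "F (a + b + c) * F a * F b * F c = F 0 * F (a + b) * F (a + c) * F (b + c)"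
proof -
  \<comment> \<open>(a, a'), (b, b') and (c, c') lie in the kernels of the first, second and third
    form, so shifting by them fixes \<open>g\<close>, \<open>h\<close> and \<open>k\<close>
    respectively.\<close>
  define a' b' c' where "a' = - (c1 * a) / d1" "b' = - (c2 * b) / d2" "c' = - (c3 * c) / d3"
  note defs = this
  define g where "g x y = G (c1 * x + d1 * y)" for x y
  define h where "h x y = H (c2 * x + d2 * y)" for x y
  define k where "k x y = K (c3 * x + d3 * y)" for x y
  have e: "F x * g x y * h x y * k x y = 1" for x y
    using eq by (simp add: g_def h_def k_def)
  have shift: "g (a + x) (a' + y) = g x y" "h (b + x) (b' + y) = h x y" "k (c + x) (c' + y) = k x y" for x y
    using d by (simp_all add: g_def h_def k_def defs distrib_left right_diff_distrib)
  have shift0: "g a a' = g 0 0" "h b b' = h 0 0" "k c c' = k 0 0"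
    using shift[of 0 0] by simp_all
  have shift2: "h (a + b) (a' + b') = h a a'" "k (a + c) (a' + c') = k a a'" "k (b + c) (b' + c') = k b b'"
    "h (a + (b + c)) (a' + (b' + c')) = h (a + c) (a' + c')"
    "k (a + (b + c)) (a' + (b' + c')) = k (a + b) (a' + b')"
    using shift(2)[of a a'] shift(3)[of a a'] shift(3)[of b b'] shift(2)[of "a + c" "a' + c'"]
      shift(3)[of "a + b" "a' + b'"] by (simp_all add: ac_simps)
  note e' = e[of 0 0] e[of a a'] e[of b b'] e[of c c'] e[of "a + b" "a' + b'"] e[of "a + c" "a' + c'"]
    e[of "b + c" "b' + c'"] e[of "a + (b + c)" "a' + (b' + c')"]
  note e'' = e'[unfolded shift shift0 shift2]
  \<comment> \<open>The equation is used at the eight vertices of the cube spanned by the three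
    shifts. After the shift rules, the four vertices with an odd number of shifts and the four
    others carry the same twelve factors \<open>g\<close>, \<open>h\<close>, \<open>k\<close>, whose
    product is \<open>Q\<close>.\<close>
  define Q where "Q = g (b + c) (b' + c') * g 0 0 * g b b' * g c c' *
    h (a + c) (a' + c') * h a a' * h 0 0 * h c c' * k (a + b) (a' + b') * k a a' * k b b' * k 0 0"
  have "(F (a + b + c) * F a * F b * F c) * Q =
    (F (a + (b + c)) * g (b + c) (b' + c') * h (a + c) (a' + c') * k (a + b) (a' + b')) *
    (F a * g 0 0 * h a a' * k a a') * (F b * g b b' * h 0 0 * k b b') * (F c * g c c' * h c c' * k 0 0)"
    by (simp add: Q_def ac_simps)
  also have "\<dots> = 1" by (simp only: e'') simp
  finally have odd: "(F (a + b + c) * F a * F b * F c) * Q = 1" .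
  have "(F 0 * F (a + b) * F (a + c) * F (b + c)) * Q =
    (F 0 * g 0 0 * h 0 0 * k 0 0) * (F (a + b) * g b b' * h a a' * k (a + b) (a' + b')) *
    (F (a + c) * g c c' * h (a + c) (a' + c') * k a a') * (F (b + c) * g (b + c) (b' + c') * h c c' * k b b')"
    by (simp add: Q_def ac_simps)
  also have "\<dots> = 1" by (simp only: e'') simp
  finally have "(F 0 * F (a + b) * F (a + c) * F (b + c)) * Q = 1" .
  with odd show ?thesis by (metis mult_cancel_right mult_zero_right zero_neq_one)
qed

context padic_field
begin

section \<open>Functional equations that force additivity\<close>

lemma isCont_0_ballD:
  fixes F :: "'a \<Rightarrow> complex"
  assumes "isCont F 0" "e > 0"
  shows "\<exists>k. \<forall>y. N y \<le> 1 / real p ^ k \<longrightarrow> cmod (F y - F 0) < e"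
proof -
  obtain d where d: "d > 0" "\<And>y. dist y 0 < d \<Longrightarrow> dist (F y) (F 0) < e"
    using assms unfolding continuous_at_eps_delta by blast
  obtain k where "N (of_nat p ^ k) < d" using N_p_power_lt[OF d(1)] by blast
  then have "1 / real p ^ k < d" by (simp add: N_power N_p power_one_over)
  then have "\<forall>y. N y \<le> 1 / real p ^ k \<longrightarrow> cmod (F y - F 0) < e"
    using d(2) by (auto simp: dist_eq dist_norm)
  then show ?thesis by blast
qed

lemma N_of_nat_mult_le: "N (of_nat n * y) \<le> N y"
  using mult_right_mono[OF N_of_nat_le_1[of n] N_nonneg[of y]] by (simp add: N_mult)

lemma N_p_power_mult_le: "\<exists>j. N (of_nat p ^ j * y) \<le> 1 / real p ^ k"
proof -
  have "1 / real p ^ k / (N y + 1) > 0" using p_gt_1 by (simp add: add_nonneg_pos)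
  then obtain j where j: "N (of_nat p ^ j) < 1 / real p ^ k / (N y + 1)"
    using N_p_power_lt by blast
  have "N (of_nat p ^ j * y) \<le> N (of_nat p ^ j) * (N y + 1)"
    unfolding N_mult by (intro mult_left_mono) auto
  also have "\<dots> < 1 / real p ^ k"
    using j by (subst (asm) pos_less_divide_eq) (auto simp: add_nonneg_pos)
  finally show ?thesis using less_imp_le by blast
qed

text \<open>The assumption \<open>third\<close> makes the defect \<open>B\<close> from additivity
  biadditive. The exponent n^2 in |F (n y)| clashes with boundedness near 0 unless |F| = 1, and then
  only values 1 and -1 remain for \<open>B\<close>.\<close>

lemma quadratic_imp_additive:
  fixes F :: "'a \<Rightarrow> complex"
  assumes nz: "\<And>y. F y \<noteq> 0" and F0: "F 0 = 1" and cnj: "\<And>y. F (- y) = cnj (F y)"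
    and cont: "isCont F 0"
    and third: "\<And>a b c. F (a + b + c) * F a * F b * F c = F 0 * F (a + b) * F (a + c) * F (b + c)"
  shows "F (x + y) = F x * F y"
proof -
  define B where "B y z = F (y + z) / (F y * F z)" for y z
  have B_add: "B (a + b) c = B a c * B b c" for a b c
    using third[of a b c] nz by (simp add: B_def F0 field_simps)
  have B_sym: "B y z = B z y" for y z by (simp add: B_def ac_simps)
  have B_0: "B 0 z = 1" for z using nz by (simp add: B_def F0)
  have B_power: "B (of_nat n * y) z = B y z ^ n" for n y z
    by (induction n) (simp_all add: B_0 B_add distrib_right)
  \<comment> \<open>Biadditivity makes B (-y) y the inverse of B y y, while conjugate symmetry makes
    it 1 / |F y|^2.\<close>
  have B_diag: "B y y = complex_of_real (cmod (F y) ^ 2)" for y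
  proof -
    have "B y y * B (- y) y = 1" using B_add[of y "- y" y] B_0 by simp
    moreover have "B (- y) y = 1 / complex_of_real (cmod (F y) ^ 2)"
      using complex_norm_square[of "F y"] by (simp add: B_def F0 cnj mult.commute)
    ultimately show ?thesis using nz[of y] by (simp add: field_simps)
  qed
  have F_add: "F (y + z) = F y * F z * B y z" for y z
    using nz by (simp add: B_def)
  \<comment> \<open>In passing from n to n + 1 the factor \<open>B y y ^ n\<close> contributes the
    exponent 2 n, and F y contributes 1.\<close>
  have norm_scale: "cmod (F (of_nat n * y)) = cmod (F y) ^ (n ^ 2)" for n y
  proof (induction n)
    case (Suc n)
    have "cmod (F (of_nat (Suc n) * y)) = cmod (F (of_nat n * y) * F y * B y y ^ n)"
      using F_add[of "of_nat n * y" y] by (simp add: distrib_right add.commute B_power)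
    also have "\<dots> = cmod (F y) ^ (n\<^sup>2 + 1 + 2 * n)"
      using Suc by (simp add: norm_mult B_diag norm_power power_add power_mult)
    also have "n\<^sup>2 + 1 + 2 * n = (Suc n)\<^sup>2" by (simp add: power2_eq_square)
    finally show ?case .
  qed (simp add: F0)
  obtain k where k: "\<And>y. N y \<le> 1 / real p ^ k \<Longrightarrow> cmod (F y - 1) < 1 / 2"
    using isCont_0_ballD[OF cont, of "1 / 2"] by (auto simp: F0)
  have small: "cmod (F y) = 1" if y: "N y \<le> 1 / real p ^ k" for y
  proof -
    \<comment> \<open>All multiples of y stay in the ball, so |F y|^(n^2) stays between 1/2 and 2
      for every n; a modulus other than 1 would leave this range.\<close>
    have bound: "1 / 2 < cmod (F y) ^ (n\<^sup>2)" "cmod (F y) ^ (n\<^sup>2) < 2" for n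
    proof -
      have "cmod (F (of_nat n * y) - 1) < 1 / 2"
        using k N_of_nat_mult_le[of n y] y by force
      then show "1 / 2 < cmod (F y) ^ (n\<^sup>2)" "cmod (F y) ^ (n\<^sup>2) < 2"
        using norm_triangle_ineq2[of "F (of_nat n * y)" 1] norm_triangle_ineq2[of 1 "F (of_nat n * y)"]
        by (auto simp: norm_scale[symmetric] norm_minus_commute)
    qed
    have n2: "n \<le> n\<^sup>2" for n :: nat by (simp add: power2_eq_square)
    show ?thesis
    proof (rule linorder_cases)
      assume "cmod (F y) < 1"
      then obtain n where "cmod (F y) ^ n < 1 / 2"
        using real_arch_pow_inv[of "1 / 2" "cmod (F y)"] by auto
      moreover have "cmod (F y) ^ (n\<^sup>2) \<le> cmod (F y) ^ n"
        using n2 \<open>cmod (F y) < 1\<close> by (intro power_decreasing) auto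
      ultimately show ?thesis using bound(1)[of n] by linarith
    next
      assume "cmod (F y) > 1"
      then obtain n where "2 < cmod (F y) ^ n" using real_arch_pow by blast
      moreover have "cmod (F y) ^ n \<le> cmod (F y) ^ (n\<^sup>2)"
        using n2 \<open>cmod (F y) > 1\<close> by (intro power_increasing) auto
      ultimately show ?thesis using bound(2)[of n] by linarith
    qed
  qed
  have "cmod (F y) = 1" for y
  proof -
    obtain j where "N (of_nat p ^ j * y) \<le> 1 / real p ^ k" using N_p_power_mult_le by blast
    then have "cmod (F y) ^ ((p ^ j)\<^sup>2) = 1"
      using small norm_scale[of "p ^ j" y] by simp
    then show ?thesis using p_gt_1 power_eq_1_iff[of "cmod (F y)"] by fastforce
  qed
  then have B_1: "B y y = 1" for y by (simp add: B_diag)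
  \<comment> \<open>Expanding B (y + z) (y + z) = 1, with \<open>B\<close> trivial on the diagonal,
    leaves B z y * B y z = 1.\<close>
  have B_sq: "B y z ^ 2 = 1" for y z
  proof -
    have "B (y + z) (y + z) = B y (y + z) * B z (y + z)" by (rule B_add)
    also have "\<dots> = B (y + z) y * B (y + z) z" by (simp only: B_sym)
    also have "\<dots> = (B y y * B z y) * (B y z * B z z)" by (simp only: B_add)
    finally show ?thesis using B_sym[of z y] by (simp add: B_1 power2_eq_square)
  qed
  \<comment> \<open>Characteristic 0 allows halving, also for p = 2.\<close>
  have "B x y = B (x / 2) y ^ 2"
    using B_add[of "x / 2" "x / 2" y] by (simp add: power2_eq_square)
  then show ?thesis using F_add B_sq by simp
qed

text \<open>The defect h satisfies h (t x) (t y) = 1 / h x y, so scaling by t^2 preserves it. As t^2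
  contracts to 0, continuity at 0 gives h = 1.\<close>

lemma additive_of_scaled_product:
  fixes F :: "'a \<Rightarrow> complex"
  assumes nz: "\<And>y. F y \<noteq> 0" and F0: "F 0 = 1" and cont: "isCont F 0" and t: "N t < 1"
    and eq: "\<And>x y. F (x + y) * F (t * (x + y)) = F x * F (t * x) * (F y * F (t * y))"
  shows "F (x + y) = F x * F y"
proof -
  define h where "h x y = F (x + y) / (F x * F y)" for x y
  have "h x y * h (t * x) (t * y) = 1" for x y
    using eq[of x y] nz by (simp add: h_def distrib_left divide_simps ac_simps)
  then have h_t: "h x y = h (t * (t * x)) (t * (t * y))" for x y
    by (metis mult.assoc mult.commute mult_1)
  have h_iter: "h x y = h ((t * t) ^ n * x) ((t * t) ^ n * y)" for n
    by (induction n) (use h_t in \<open>simp_all add: mult.assoc\<close>)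
  have lim: "(\<lambda>n. (t * t) ^ n * z) \<longlonglongrightarrow> 0" for z
  proof -
    have "N t * N t \<le> N t * 1" using t by (intro mult_left_mono) auto
    then have "(\<lambda>n. N (t * t) ^ n * N z) \<longlonglongrightarrow> 0 * N z"
      using t by (intro tendsto_mult LIMSEQ_realpow_zero tendsto_const) (auto simp: N_mult)
    then show ?thesis by (subst tendsto_dist_iff) (simp add: dist_eq N_mult N_power)
  qed
  have F_lim: "(\<lambda>n. F ((t * t) ^ n * z)) \<longlonglongrightarrow> 1" for z
    using isCont_tendsto_compose[OF cont lim] by (simp add: F0)
  have "(\<lambda>n. h ((t * t) ^ n * x) ((t * t) ^ n * y)) \<longlonglongrightarrow> 1 / (1 * 1)"
    unfolding h_def distrib_left[symmetric] by (intro tendsto_intros F_lim) auto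
  then have "(\<lambda>n::nat. h x y) \<longlonglongrightarrow> 1" by (simp flip: h_iter)
  then have "h x y = 1" by (simp add: LIMSEQ_const_iff)
  then show ?thesis using nz by (simp add: h_def)
qed

section \<open>Self-duality of the additive group\<close>

lemma psi_eq_iff: "psi x = psi y \<longleftrightarrow> N (x - y) \<le> 1"
proof -
  have "psi y \<noteq> 0" by (metis cmod_psi norm_zero zero_neq_one)
  then show ?thesis
    using psi_add[of "x - y" y] by (auto simp flip: psi_eq_1_iff)
qed

text \<open>After rescaling, the character is trivial on the unit ball, so its values at 1 / p^n are
  roots of unity. Their exponents are coherent modulo powers of p and converge to the p-adic integer
  that represents the character.\<close>

lemma unimodular_additive_imp_psi:
  fixes F :: "'a \<Rightarrow> complex"
  assumes add: "\<And>x y. F (x + y) = F x * F y" and norm: "\<And>x. cmod (F x) = 1" and cont: "isCont F 0"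
  shows "\<exists>\<alpha>. \<forall>y. F y = psi (\<alpha> * y)"
proof -
  have nz: "F x \<noteq> 0" for x using norm[of x] by auto
  have F0: "F 0 = 1" using add[of 0 0] nz by simp
  have F_power: "F (of_nat n * y) = F y ^ n" for n y
    by (induction n) (simp_all add: F0 add distrib_right)
  obtain k where k: "\<And>y. N y \<le> 1 / real p ^ k \<Longrightarrow> cmod (F y - 1) < 1 / 2"
    using isCont_0_ballD[OF cont, of "1 / 2"] by (auto simp: F0)
  \<comment> \<open>The powers F y ^ n = F (n y) all stay near 1, so F is trivial on a whole
    ball.\<close>
  have F_1: "F y = 1" if "N y \<le> 1 / real p ^ k" for y
  proof (rule unimodular_eq_1_if_powers_near_1[OF norm])
    fix n
    have "N (of_nat n * y) \<le> 1 / real p ^ k" using N_of_nat_mult_le[of n y] that by linarith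
    then show "cmod (F y ^ n - 1) \<le> 1 / 2" using k F_power by (metis less_imp_le)
  qed
  \<comment> \<open>Multiplication by p^k maps the unit ball into the ball where F is
    trivial.\<close>
  define G where "G y = F (of_nat p ^ k * y)" for y
  have G_add: "G (x + y) = G x * G y" for x y by (simp add: G_def distrib_left add)
  have G_power: "G (of_nat n * y) = G y ^ n" for n y
    by (simp add: G_def F_power[symmetric] mult.left_commute)
  have G_1: "G y = 1" if "N y \<le> 1" for y
    using that p_gt_1 by (auto simp: G_def N_mult N_power N_p power_one_over intro!: F_1 divide_right_mono)
  \<comment> \<open>Since G 1 = 1, the value at 1 / p^n is a p^n-th root of unity; \<open>c\<close>
    is its exponent.\<close>
  have "\<exists>c. G (1 / of_nat p ^ n) = psi (of_nat c / of_nat p ^ n)" for n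
  proof -
    have "G (1 / of_nat p ^ n) ^ (p ^ n) = G 1"
      using G_power[of "p ^ n" "1 / of_nat p ^ n"] p_gt_1 by simp
    then have "G (1 / of_nat p ^ n) ^ (p ^ n) = 1" by (simp add: G_1)
    then have "G (1 / of_nat p ^ n) \<in> (\<lambda>j. cis (2 * pi * real j / real (p ^ n))) ` {..<p ^ n}"
      using bij_betw_imp_surj_on[OF Complex.bij_betw_roots_unity, of "p ^ n"] p_gt_1
      by (simp del: of_nat_power)
    then obtain c where c: "G (1 / of_nat p ^ n) = cis (2 * pi * real c / real (p ^ n))"
      by blast
    have "of_int (int c) / of_nat p ^ n \<in> pfrac" unfolding pfrac_def by blast
    then have "of_nat c / of_nat p ^ n \<in> pfrac" by simp
    from psi_eq[OF this, of "of_nat c / of_nat p ^ n"] c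
    have "G (1 / of_nat p ^ n) = psi (of_nat c / of_nat p ^ n)"
      by (simp add: of_rat_divide of_rat_power)
    then show ?thesis by blast
  qed
  then obtain c where c: "\<And>n. G (1 / of_nat p ^ n) = psi (of_nat (c n) / of_nat p ^ n)" by metis
  have N_div: "N (x / of_nat p ^ n) \<le> 1 \<longleftrightarrow> N x \<le> 1 / real p ^ n" for x n
    using p_gt_1 by (simp add: N_divide N_power N_p field_simps)
  \<comment> \<open>Raising the identity for m to the power p^(m - n) gives the one for n, so the
    exponents agree modulo p^n.\<close>
  have c_diff: "N (of_nat (c m) - of_nat (c n)) \<le> 1 / real p ^ n" if "m \<ge> n" for m n
  proof -
    have "(of_nat p :: 'a) ^ m = of_nat p ^ (m - n) * of_nat p ^ n"
      using that by (simp flip: power_add)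
    then have "psi (of_nat (c n) / of_nat p ^ n) = psi (of_nat (c m) / of_nat p ^ n)"
      using G_power[of "p ^ (m - n)" "1 / of_nat p ^ m"] c[of n] c[of m] p_gt_1
        psi_power[of "of_nat (c m) / of_nat p ^ m" "p ^ (m - n)"] by simp
    then show ?thesis
      using N_minus_commute[of "of_nat (c m)"] by (simp add: psi_eq_iff N_div flip: diff_divide_distrib)
  qed
  have "Cauchy (\<lambda>n. of_nat (c n) :: 'a)"
  proof (rule metric_CauchyI)
    fix e :: real assume "e > 0"
    then obtain n where n: "N (of_nat p ^ n) < e" using N_p_power_lt by blast
    have "dist (of_nat (c i)) (of_nat (c j) :: 'a) < e" if "i \<ge> n" "j \<ge> n" for i j
      using N_diff[of "of_nat (c i) - of_nat (c n)" "of_nat (c j) - of_nat (c n)"]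
        c_diff[OF that(1)] c_diff[OF that(2)] n
      by (auto simp: dist_eq N_power N_p power_one_over)
    then show "\<exists>n. \<forall>i\<ge>n. \<forall>j\<ge>n. dist (of_nat (c i)) (of_nat (c j) :: 'a) < e" by blast
  qed
  moreover have "Topological_Spaces.complete (UNIV :: 'a set)"
    using model by (simp add: Qp_model_def)
  ultimately obtain \<gamma> :: 'a where \<gamma>: "(\<lambda>n. of_nat (c n)) \<longlonglongrightarrow> \<gamma>"
    unfolding complete_def by blast
  \<comment> \<open>The congruences pass to the limit: the index \<open>max m0 n\<close> is late
    enough both for convergence and for \<open>c_diff\<close>.\<close>
  have \<gamma>_diff: "N (\<gamma> - of_nat (c n)) \<le> 1 / real p ^ n" for n
  proof -
    have "1 / real p ^ n > 0" using p_gt_1 by simp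
    then obtain m0 where "\<And>m. m \<ge> m0 \<Longrightarrow> dist (of_nat (c m)) \<gamma> < 1 / real p ^ n"
      using metric_LIMSEQ_D[OF \<gamma>] by blast
    then have "N (\<gamma> - of_nat (c (max m0 n))) < 1 / real p ^ n"
      by (metis dist_eq dist_commute max.cobounded1)
    moreover have "N (of_nat (c (max m0 n)) - of_nat (c n)) \<le> 1 / real p ^ n"
      by (rule c_diff) simp
    ultimately show ?thesis
      using N_add[of "\<gamma> - of_nat (c (max m0 n))" "of_nat (c (max m0 n)) - of_nat (c n)"] by auto
  qed
  have N_\<gamma>: "N \<gamma> \<le> 1"
    using \<gamma>_diff[of 0] N_add[of "\<gamma> - of_nat (c 0)" "of_nat (c 0)"] N_of_nat_le_1[of "c 0"] by auto
  have G_inverse_power: "G (1 / of_nat p ^ n) = psi (\<gamma> * (1 / of_nat p ^ n))" for n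
    using \<gamma>_diff[of n] c[of n] N_minus_commute[of \<gamma>]
    by (simp add: psi_eq_iff N_div flip: diff_divide_distrib)
  have G_nat: "G (of_nat m / of_nat p ^ n) = psi (\<gamma> * (of_nat m / of_nat p ^ n))" for m n
    using G_power[of m "1 / of_nat p ^ n"] G_inverse_power[of n] psi_power[of "\<gamma> * (1 / of_nat p ^ n)" m]
    by (simp add: ac_simps)
  have minus: "G (- y) = psi (\<gamma> * - y)" if "G y = psi (\<gamma> * y)" for y
  proof -
    have "G y * G (- y) = psi (\<gamma> * y) * psi (\<gamma> * - y)"
      using G_add[of y "- y"] psi_add[of "\<gamma> * y" "- (\<gamma> * y)"] G_1[of 0] by simp
    moreover have "G y \<noteq> 0" using nz by (simp add: G_def)
    ultimately show ?thesis using that by simp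
  qed
  have G_frac: "G (of_rat r) = psi (\<gamma> * of_rat r)" if r: "r \<in> pfrac" for r
  proof -
    obtain d n where r: "r = of_int d / of_nat p ^ n" using r by (auto simp: pfrac_def)
    show ?thesis
    proof (cases d rule: int_cases2)
      case (nonneg m)
      then show ?thesis using G_nat[of m n] by (simp add: r of_rat_divide of_rat_power)
    next
      case (nonpos m)
      then show ?thesis
        using minus[OF G_nat[of m n]] by (simp add: r of_rat_divide of_rat_power of_rat_minus)
    qed
  qed
  \<comment> \<open>Both characters are trivial on the unit ball and agree on Z[1/p], which meets
    every class modulo that ball.\<close>
  have G_psi: "G x = psi (\<gamma> * x)" for x
  proof -
    obtain r where r: "r \<in> pfrac" "N (x - of_rat r) \<le> 1" using pfrac_approx by blast
    have "psi (\<gamma> * (x - of_rat r)) = 1"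
      using mult_mono[OF N_\<gamma> r(2)] by (simp add: psi_eq_1_iff N_mult)
    then show ?thesis
      using G_add[of "x - of_rat r" "of_rat r"] psi_add[of "\<gamma> * (x - of_rat r)" "\<gamma> * of_rat r"]
        G_1[OF r(2)] G_frac[OF r(1)] by (simp add: distrib_left[symmetric])
  qed
  have "F y = psi (\<gamma> / of_nat p ^ k * y)" for y
    using G_psi[of "y / of_nat p ^ k"] p_gt_1 by (simp add: G_def)
  then show ?thesis by blast
qed

end

section \<open>Linear forms in independent random variables\<close>

definition pair_law ::
    "'a \<Rightarrow> 'a \<Rightarrow> 'a \<Rightarrow> 'a \<Rightarrow> 'w measure \<Rightarrow> (nat \<Rightarrow> 'w \<Rightarrow> 'a :: {semiring, topological_space}) \<Rightarrow> ('a \<times> 'a) measure"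
  where "pair_law a2 a3 b2 b3 M X = distr M (borel \<Otimes>\<^sub>M borel)
     (\<lambda>\<omega>. (X 1 \<omega> + a2 * X 2 \<omega> + a3 * X 3 \<omega>, b2 * X 2 \<omega> + b3 * X 3 \<omega> + X 4 \<omega>))"

context padic_field
begin

section \<open>Characteristic functions of the variables and of the two forms\<close>

lemma integrable_psi:
  assumes "prob_space M" "X \<in> borel_measurable M"
  shows "integrable M (\<lambda>\<omega>. psi (y * X \<omega>))"
proof -
  interpret prob_space M by fact
  have "(\<lambda>\<omega>. psi (y * X \<omega>)) \<in> borel_measurable M"
    using measurable_compose[OF assms(2) psi_measurable] .
  then show ?thesis by (intro integrable_const_bound[where B = 1]) auto
qed

lemma cf_0: "prob_space M \<Longrightarrow> cf M X 0 = 1"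
  by (simp add: cf_def prob_space.prob_space)

lemma cf_minus: "cf M X (- y) = cnj (cf M X y)"
  by (simp add: cf_def psi_minus)

lemma isCont_cf_0:
  assumes "prob_space M" and X: "X \<in> borel_measurable M"
  shows "isCont (cf M X) 0"
  unfolding continuous_at_sequentially
proof (intro allI impI)
  interpret prob_space M by fact
  fix u :: "nat \<Rightarrow> 'a" assume u: "u \<longlonglongrightarrow> 0"
  have "(\<lambda>n. \<integral>\<omega>. psi (u n * X \<omega>) \<partial>M) \<longlonglongrightarrow> (\<integral>\<omega>. psi (0 * X \<omega>) \<partial>M)"
  proof (rule integral_dominated_convergence[where w = "\<lambda>_. 1"])
    show "AE \<omega> in M. (\<lambda>n. psi (u n * X \<omega>)) \<longlonglongrightarrow> psi (0 * X \<omega>)"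
    proof (rule AE_I2)
      fix \<omega>
      have "isCont (\<lambda>y. psi (X \<omega> * y)) 0"
        using is_character_psi[of "X \<omega>"] by (simp add: is_character_def continuous_on_eq_continuous_at)
      from isCont_tendsto_compose[OF this u]
      show "(\<lambda>n. psi (u n * X \<omega>)) \<longlonglongrightarrow> psi (0 * X \<omega>)" by (simp add: mult.commute)
    qed
  qed (use integrable_psi[OF assms] in auto)
  then show "(cf M X \<circ> u) \<longlonglongrightarrow> cf M X 0" by (simp add: cf_def comp_def)
qed

lemma nowhere_vanishing_imp_cf_neq_0: "nowhere_vanishing_cf M X \<Longrightarrow> cf M X y \<noteq> 0"
  unfolding nowhere_vanishing_cf_def cf_def using is_character_psi[of y] by blast

lemma cf_add_const: "cf M (\<lambda>\<omega>. X \<omega> + \<alpha>) y = psi (\<alpha> * y) * cf M X y"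
  by (simp add: cf_def psi_add distrib_left mult.commute)

text \<open>Additivity gives f y * f (- y) = 1, and f (- y) is the conjugate of f y, so f is
  unimodular. Self-duality then supplies the shift, and uniqueness of characteristic functions
  identifies the laws.\<close>

lemma distr_eq_shift:
  fixes X :: "'w \<Rightarrow> 'a" and Y :: "'v \<Rightarrow> 'a"
  assumes M: "prob_space M" "X \<in> borel_measurable M" and nz: "\<And>y. cf M X y \<noteq> 0"
    and M': "prob_space M'" "Y \<in> borel_measurable M'"
    and f: "\<And>y. f y = cf M' Y y / cf M X y" and add: "\<And>x y. f (x + y) = f x * f y"
  shows "\<exists>\<alpha>. distr M' borel Y = distr M borel (\<lambda>\<omega>. X \<omega> + \<alpha>)"
proof -
  have f0: "f 0 = 1" using M M' by (simp add: f cf_0)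
  have "cmod (f y) = 1" for y
  proof -
    have "f y * cnj (f y) = 1"
      using add[of y "- y"] by (simp add: f0) (simp add: f cf_minus)
    then have "complex_of_real ((cmod (f y))\<^sup>2) = of_real 1"
      by (simp only: complex_norm_square of_real_1)
    then have "(cmod (f y))\<^sup>2 = 1" by (simp only: of_real_eq_iff)
    then show ?thesis using power_eq_1_iff[of "cmod (f y)" 2] by simp
  qed
  moreover have "isCont f 0"
  proof -
    have "f = (\<lambda>y. cf M' Y y / cf M X y)" using f by auto
    then show ?thesis using isCont_cf_0[OF M] isCont_cf_0[OF M'] nz by simp
  qed
  ultimately obtain \<alpha> where \<alpha>: "\<And>y. f y = psi (\<alpha> * y)"
    using unimodular_additive_imp_psi[of f] add by auto
  have X\<alpha>: "(\<lambda>\<omega>. X \<omega> + \<alpha>) \<in> borel_measurable M"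
    using M(2) by (intro borel_measurable_padic_add) auto
  have "distr M' borel Y = distr M borel (\<lambda>\<omega>. X \<omega> + \<alpha>)"
  proof (rule cf_uniqueness)
    show "prob_space (distr M' borel Y)" using M' by (rule prob_space.prob_space_distr)
    show "prob_space (distr M borel (\<lambda>\<omega>. X \<omega> + \<alpha>))" using M(1) X\<alpha> by (rule prob_space.prob_space_distr)
    fix y
    have "cf M' Y y = cf M (\<lambda>\<omega>. X \<omega> + \<alpha>) y"
      using nz[of y] f[of y] \<alpha>[of y] unfolding cf_add_const by (simp add: field_simps)
    then show "cf (distr M' borel Y) (\<lambda>x. x) y = cf (distr M borel (\<lambda>\<omega>. X \<omega> + \<alpha>)) (\<lambda>x. x) y"
      by (simp add: cf_distr M'(2) X\<alpha>)
  qed simp_all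
  then show ?thesis by blast
qed

text \<open>Collecting the terms in each variable turns the integrand into a product of functions of
  single variables, and independence factors the integral.\<close>

lemma pair_law_cf:
  fixes X :: "nat \<Rightarrow> 'w \<Rightarrow> 'a"
  assumes nonzero: "a2 \<noteq> 0" "a3 \<noteq> 0" "b2 \<noteq> 0" "b3 \<noteq> 0"
    and M: "prob_space M" and indep: "prob_space.indep_vars M (\<lambda>_. borel) X {1, 2, 3, 4}"
  shows "(\<integral>z. psi (u * fst z) * psi (v * snd z) \<partial>pair_law a2 a3 b2 b3 M X) =
    cf M (X 1) u * cf M (X 2) (a2 * u + b2 * v) * cf M (X 3) (a3 * u + b3 * v) * cf M (X 4) v"
proof -
  interpret prob_space M by fact
  have meas: "X j \<in> borel_measurable M" if "j \<in> {1, 2, 3, 4}" for j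
    using indep that by (auto simp: indep_vars_def)
  \<comment> \<open>\<open>w j\<close> is the coefficient of \<open>X j\<close> in u times the first
    form plus v times the second.\<close>
  define w where "w j = (if j = 1 then u else if j = 2 then a2 * u + b2 * v
    else if j = 3 then a3 * u + b3 * v else v)" for j :: nat
  have "(\<lambda>\<omega>. (X 1 \<omega> + a2 * X 2 \<omega> + a3 * X 3 \<omega>, b2 * X 2 \<omega> + b3 * X 3 \<omega> + X 4 \<omega>))
      \<in> M \<rightarrow>\<^sub>M borel \<Otimes>\<^sub>M borel"
    using nonzero
    by (intro measurable_Pair borel_measurable_padic_add borel_measurable_padic_mult meas) auto
  moreover have "(\<lambda>z::'a \<times> 'a. psi (u * fst z) * psi (v * snd z)) \<in> borel_measurable (borel \<Otimes>\<^sub>M borel)"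
    by (intro borel_measurable_times measurable_compose[OF measurable_fst psi_measurable]
      measurable_compose[OF measurable_snd psi_measurable])
  ultimately have "(\<integral>z. psi (u * fst z) * psi (v * snd z) \<partial>pair_law a2 a3 b2 b3 M X) =
      (\<integral>\<omega>. psi (u * (X 1 \<omega> + a2 * X 2 \<omega> + a3 * X 3 \<omega>)) * psi (v * (b2 * X 2 \<omega> + b3 * X 3 \<omega> + X 4 \<omega>)) \<partial>M)"
    unfolding pair_law_def by (subst integral_distr) simp_all
  also have "\<dots> = (\<integral>\<omega>. (\<Prod>j\<in>{1, 2, 3, 4}. psi (w j * X j \<omega>)) \<partial>M)"
    by (intro Bochner_Integration.integral_cong refl)
      (simp add: w_def psi_add[symmetric] algebra_simps)
  also have "\<dots> = (\<Prod>j\<in>{1, 2, 3, 4}. cf M (X j) (w j))"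
    unfolding cf_def
    using indep_vars_compose2[OF indep, of "\<lambda>j x. psi (w j * x)" "\<lambda>_. borel"] integrable_psi[OF M meas]
    by (intro indep_vars_lebesgue_integral) auto
  also have "\<dots> = cf M (X 1) u * cf M (X 2) (a2 * u + b2 * v) * cf M (X 3) (a3 * u + b3 * v) * cf M (X 4) v"
    by (simp add: w_def)
  finally show ?thesis .
qed

text \<open>Each f j in turn is made the factor depending on x alone by a linear change of
  variables. The third difference identity applies because the other three forms then have nonzero
  y-coefficients.\<close>

lemma functional_equation_imp_additive:
  fixes f :: "nat \<Rightarrow> 'a \<Rightarrow> complex"
  assumes nonzero: "a2 \<noteq> 0" "a3 \<noteq> 0" "b2 \<noteq> 0" "b3 \<noteq> 0" and det: "a2 * b3 \<noteq> a3 * b2"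
    and nz: "\<And>j y. j \<in> {1, 2, 3, 4} \<Longrightarrow> f j y \<noteq> 0"
    and f0: "\<And>j. j \<in> {1, 2, 3, 4} \<Longrightarrow> f j 0 = 1"
    and cnj: "\<And>j y. j \<in> {1, 2, 3, 4} \<Longrightarrow> f j (- y) = cnj (f j y)"
    and cont: "\<And>j. j \<in> {1, 2, 3, 4} \<Longrightarrow> isCont (f j) 0"
    and eq: "\<And>u v. f 1 u * f 2 (a2 * u + b2 * v) * f 3 (a3 * u + b3 * v) * f 4 v = 1"
    and j: "j \<in> {1, 2, 3, 4}"
  shows "f j (x + y) = f j x * f j y"
proof (rule quadratic_imp_additive[OF nz[OF j] f0[OF j] cnj[OF j] cont[OF j]])
  fix a b c
  have "f 1 x * f 2 (a2 * x + b2 * y) * f 3 (a3 * x + b3 * y) * f 4 (0 * x + 1 * y) = 1" for x y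
    using eq[of x y] by simp
  note 1 = third_difference_eq[where F = "f 1" and G = "f 2" and H = "f 3" and K = "f 4",
      OF this nonzero(3,4) one_neq_zero]
  have "f 4 x * f 2 (b2 * x + a2 * y) * f 3 (b3 * x + a3 * y) * f 1 (0 * x + 1 * y) = 1" for x y
    using eq[of y x] by (simp add: ac_simps)
  note 4 = third_difference_eq[where F = "f 4" and G = "f 2" and H = "f 3" and K = "f 1",
      OF this nonzero(1,2) one_neq_zero]
  \<comment> \<open>The substitution u = (x - b2 y) / a2, v = y turns the argument of f 2 into
    x.\<close>
  have "f 2 x * f 1 (1 / a2 * x + - (b2 / a2) * y) * f 3 (a3 / a2 * x + (b3 - a3 * b2 / a2) * y)
      * f 4 (0 * x + 1 * y) = 1" for x y
    using eq[of "(x - b2 * y) / a2" y] nonzero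
    by (simp add: algebra_simps diff_divide_distrib)
  note 2 = third_difference_eq[where F = "f 2" and G = "f 1" and H = "f 3" and K = "f 4", OF this]
  have "f 3 x * f 1 (1 / a3 * x + - (b3 / a3) * y) * f 2 (a2 / a3 * x + (b2 - a2 * b3 / a3) * y)
      * f 4 (0 * x + 1 * y) = 1" for x y
    using eq[of "(x - b3 * y) / a3" y] nonzero
    by (simp add: algebra_simps diff_divide_distrib)
  note 3 = third_difference_eq[where F = "f 3" and G = "f 1" and H = "f 2" and K = "f 4", OF this]
  \<comment> \<open>The last two coefficients are the determinant a2 b3 - a3 b2 up to sign, divided
    by a2 and a3.\<close>
  have "- (b2 / a2) \<noteq> 0" "- (b3 / a3) \<noteq> 0" "b3 - a3 * b2 / a2 \<noteq> 0" "b2 - a2 * b3 / a3 \<noteq> 0"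
    using nonzero det by (auto simp: field_simps)
  then show "f j (a + b + c) * f j a * f j b * f j c = f j 0 * f j (a + b) * f j (a + c) * f j (b + c)"
    using 1 2 3 4 j by auto
qed

text \<open>The two inner forms are proportional with ratio t, so f 2 and f 3 merge into one
  function \<open>g\<close> of a single form. Multiplicativity of \<open>g\<close> passes to f 1 and
  f 4 directly, and to f 2 by contraction.\<close>

lemma degenerate_functional_equation_imp_additive:
  fixes f :: "nat \<Rightarrow> 'a \<Rightarrow> complex"
  assumes nonzero: "a2 \<noteq> 0" "a3 \<noteq> 0" "b2 \<noteq> 0" "b3 \<noteq> 0"
    and det: "a2 * b3 = a3 * b2" and N: "N a2 \<noteq> N a3"
    and nz: "\<And>j y. j \<in> {1, 2, 3, 4} \<Longrightarrow> f j y \<noteq> 0"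
    and f0: "\<And>j. j \<in> {1, 2, 3, 4} \<Longrightarrow> f j 0 = 1"
    and cont: "\<And>j. j \<in> {1, 2, 3, 4} \<Longrightarrow> isCont (f j) 0"
    and f23: "f 3 = f 2"
    and eq: "\<And>u v. f 1 u * f 2 (a2 * u + b2 * v) * f 3 (a3 * u + b3 * v) * f 4 v = 1"
    and j: "j \<in> {1, 2, 3, 4}"
  shows "f j (x + y) = f j x * f j y"
proof -
  define t where "t = a3 / a2"
  define g where "g y = f 2 y * f 2 (t * y)" for y
  have b3: "b3 = t * b2" using det nonzero by (simp add: t_def field_simps)
  have a3: "a3 = t * a2" using nonzero by (simp add: t_def)
  have eq': "f 1 u * g (a2 * u + b2 * v) * f 4 v = 1" for u v
    using eq[of u v] by (simp add: f23 g_def a3 b3 distrib_left mult.assoc)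
  \<comment> \<open>Setting v = 0 or u = 0 expresses f 1 and f 4 through \<open>g\<close>; put back,
    the equation says that \<open>g\<close> is multiplicative.\<close>
  have f1: "f 1 u * g (a2 * u) = 1" for u using eq'[of u 0] f0 by simp
  have f4: "g (b2 * v) * f 4 v = 1" for v using eq'[of 0 v] f0 by simp
  have g_nz: "g y \<noteq> 0" for y using nz by (simp add: g_def)
  have g_add: "g (x + y) = g x * g y" for x y
  proof -
    have "f 1 (x / a2) * g (x + y) * f 4 (y / b2) = 1"
      using eq'[of "x / a2" "y / b2"] nonzero by simp
    moreover have "f 1 (x / a2) = 1 / g x" "f 4 (y / b2) = 1 / g y"
      using f1[of "x / a2"] f4[of "y / b2"] g_nz nonzero by (simp_all add: field_simps)
    ultimately have "1 / g x * g (x + y) * (1 / g y) = 1" by (simp only:)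
    then show ?thesis using g_nz by (simp add: divide_simps split: if_splits)
  qed
  have N_t: "N t \<noteq> 1" and t: "t \<noteq> 0"
    using N nonzero by (auto simp: t_def N_divide)
  have f2_add: "f 2 (x + y) = f 2 x * f 2 y" for x y
  proof (cases "N t < 1")
    case True
    show ?thesis
      by (rule additive_of_scaled_product[OF nz f0 cont True]) (use g_add in \<open>simp_all add: g_def\<close>)
  next
    case False
    then have s: "N (1 / t) < 1" using N_t by (simp add: N_divide)
    \<comment> \<open>If t expands, 1 / t contracts, and the corresponding product is again a value
      of \<open>g\<close>.\<close>
    have "f 2 y * f 2 (1 / t * y) = g (1 / t * y)" for y using t by (simp add: g_def)
    then have "f 2 (x + y) * f 2 (1 / t * (x + y)) = f 2 x * f 2 (1 / t * x) * (f 2 y * f 2 (1 / t * y))"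
      for x y by (metis g_add distrib_left)
    then show ?thesis by (intro additive_of_scaled_product[OF nz f0 cont s]) auto
  qed
  have "f 1 (x + y) = f 1 x * f 1 y"
  proof -
    have "f 1 z = 1 / g (a2 * z)" for z using f1[of z] g_nz by (simp add: field_simps)
    then show ?thesis by (simp add: g_add distrib_left)
  qed
  moreover have "f 4 (x + y) = f 4 x * f 4 y"
  proof -
    have "f 4 z = 1 / g (b2 * z)" for z using f4[of z] g_nz by (simp add: field_simps)
    then show ?thesis by (simp add: g_add distrib_left)
  qed
  ultimately show ?thesis using j f2_add f23 by auto
qed

lemma distr_eq_shift_of_pair_law_eq:
  fixes X :: "nat \<Rightarrow> 'w \<Rightarrow> 'a" and Y :: "nat \<Rightarrow> 'v \<Rightarrow> 'a"
  assumes nonzero: "a2 \<noteq> 0" "a3 \<noteq> 0" "b2 \<noteq> 0" "b3 \<noteq> 0"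
    and M: "prob_space M" "prob_space.indep_vars M (\<lambda>_. borel) X {1, 2, 3, 4}"
      "\<forall>j\<in>{1, 2, 3, 4}. nowhere_vanishing_cf M (X j)"
    and M': "prob_space M'" "prob_space.indep_vars M' (\<lambda>_. borel) Y {1, 2, 3, 4}"
      "\<forall>j\<in>{1, 2, 3, 4}. nowhere_vanishing_cf M' (Y j)"
    and law: "pair_law a2 a3 b2 b3 M' Y = pair_law a2 a3 b2 b3 M X"
    and cond: "a2 * b3 \<noteq> a3 * b2 \<or>
      (N a2 \<noteq> N a3 \<and> distr M borel (X 2) = distr M borel (X 3) \<and> distr M' borel (Y 2) = distr M' borel (Y 3))"
  shows "\<exists>\<alpha>. \<forall>j\<in>{1, 2, 3, 4}. distr M' borel (Y j) = distr M borel (\<lambda>\<omega>. X j \<omega> + \<alpha> j)"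
proof -
  have X: "X j \<in> borel_measurable M" if "j \<in> {1, 2, 3, 4}" for j
    using M(2) that by (auto simp: prob_space.indep_vars_def[OF M(1)])
  have Y: "Y j \<in> borel_measurable M'" if "j \<in> {1, 2, 3, 4}" for j
    using M'(2) that by (auto simp: prob_space.indep_vars_def[OF M'(1)])
  have X_nz: "cf M (X j) y \<noteq> 0" if "j \<in> {1, 2, 3, 4}" for j y
    using that M(3) nowhere_vanishing_imp_cf_neq_0 by blast
  have Y_nz: "cf M' (Y j) y \<noteq> 0" if "j \<in> {1, 2, 3, 4}" for j y
    using that M'(3) nowhere_vanishing_imp_cf_neq_0 by blast
  define f where "f j y = cf M' (Y j) y / cf M (X j) y" for j y
  have nz: "f j y \<noteq> 0" if "j \<in> {1, 2, 3, 4}" for j y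
    using X_nz[OF that] Y_nz[OF that] by (simp add: f_def)
  have f0: "f j 0 = 1" for j by (simp add: f_def cf_0 M M')
  have cnj: "f j (- y) = cnj (f j y)" for j y by (simp add: f_def cf_minus)
  have cont: "isCont (f j) 0" if "j \<in> {1, 2, 3, 4}" for j
    unfolding f_def
    by (intro continuous_intros isCont_cf_0 M(1) M'(1) X Y X_nz that)
  \<comment> \<open>Equal joint laws have equal transforms; dividing their two factorizations gives
    the equation.\<close>
  have eq: "f 1 u * f 2 (a2 * u + b2 * v) * f 3 (a3 * u + b3 * v) * f 4 v = 1" for u v
    using pair_law_cf[OF nonzero M(1,2), of u v] pair_law_cf[OF nonzero M'(1,2), of u v] X_nz Y_nz
    by (simp add: f_def law)
  have add: "f j (x + y) = f j x * f j y" if j: "j \<in> {1, 2, 3, 4}" for j x y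
  proof (cases "a2 * b3 = a3 * b2")
    case True
    with cond have N: "N a2 \<noteq> N a3" and "distr M borel (X 2) = distr M borel (X 3)"
      and "distr M' borel (Y 2) = distr M' borel (Y 3)" by auto
    then have "cf M (X 3) y = cf M (X 2) y" "cf M' (Y 3) y = cf M' (Y 2) y" for y
      using cf_distr[OF X[of 2]] cf_distr[OF X[of 3]] cf_distr[OF Y[of 2]] cf_distr[OF Y[of 3]] by simp_all
    then have "f 3 = f 2" by (auto simp: f_def)
    then show ?thesis
      using degenerate_functional_equation_imp_additive[OF nonzero True N nz f0 cont _ eq j] by blast
  next
    case False
    show ?thesis
      by (rule functional_equation_imp_additive[OF nonzero False nz f0 cnj cont eq j])
  qed
  have "\<forall>j\<in>{1, 2, 3, 4}. \<exists>\<alpha>. distr M' borel (Y j) = distr M borel (\<lambda>\<omega>. X j \<omega> + \<alpha>)"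
  proof
    fix j :: nat assume j: "j \<in> {1, 2, 3, 4}"
    show "\<exists>\<alpha>. distr M' borel (Y j) = distr M borel (\<lambda>\<omega>. X j \<omega> + \<alpha>)"
      by (rule distr_eq_shift[OF M(1) X[OF j] X_nz[OF j] M'(1) Y[OF j] f_def add[OF j]])
  qed
  then show ?thesis by (rule bchoice)
qed

end

theorem theorem3p2:
  fixes p :: nat
    and N :: "'a::{field_char_0, metric_space} \<Rightarrow> real"
    and a2 a3 b2 b3 :: 'a
    and M :: "'w measure"
    and \<xi> :: "nat \<Rightarrow> 'w \<Rightarrow> 'a"
  assumes "prime p"
    and "Qp_model p N"
    and "a2 \<noteq> 0" "a3 \<noteq> 0" "b2 \<noteq> 0" "b3 \<noteq> 0"
    and "prob_space M"
    and "prob_space.indep_vars M (\<lambda>_. borel) \<xi> {1, 2, 3, 4}"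
    and "\<forall>j\<in>{1, 2, 3, 4}. nowhere_vanishing_cf M (\<xi> j)"
  shows
   "(a2 * b3 \<noteq> a3 * b2 \<longrightarrow>
      (\<forall>(M' :: 'v measure) (\<eta> :: nat \<Rightarrow> 'v \<Rightarrow> 'a).
         prob_space M' \<and>
         prob_space.indep_vars M' (\<lambda>_. borel) \<eta> {1, 2, 3, 4} \<and>
         (\<forall>j\<in>{1, 2, 3, 4}. nowhere_vanishing_cf M' (\<eta> j)) \<and>
         distr M' (borel \<Otimes>\<^sub>M borel)
           (\<lambda>\<omega>. (\<eta> 1 \<omega> + a2 * \<eta> 2 \<omega> + a3 * \<eta> 3 \<omega>, b2 * \<eta> 2 \<omega> + b3 * \<eta> 3 \<omega> + \<eta> 4 \<omega>))
         = distr M (borel \<Otimes>\<^sub>M borel)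
           (\<lambda>\<omega>. (\<xi> 1 \<omega> + a2 * \<xi> 2 \<omega> + a3 * \<xi> 3 \<omega>, b2 * \<xi> 2 \<omega> + b3 * \<xi> 3 \<omega> + \<xi> 4 \<omega>))
         \<longrightarrow> (\<exists>\<alpha> :: nat \<Rightarrow> 'a. \<forall>j\<in>{1, 2, 3, 4}.
                distr M' borel (\<eta> j) = distr M borel (\<lambda>\<omega>. \<xi> j \<omega> + \<alpha> j)))) \<and>
    (a2 * b3 = a3 * b2 \<and> N a2 \<noteq> N a3 \<and> distr M borel (\<xi> 2) = distr M borel (\<xi> 3) \<longrightarrow>
      (\<forall>(M' :: 'v measure) (\<eta> :: nat \<Rightarrow> 'v \<Rightarrow> 'a).
         prob_space M' \<and>
         prob_space.indep_vars M' (\<lambda>_. borel) \<eta> {1, 2, 3, 4} \<and>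
         (\<forall>j\<in>{1, 2, 3, 4}. nowhere_vanishing_cf M' (\<eta> j)) \<and>
         distr M' borel (\<eta> 2) = distr M' borel (\<eta> 3) \<and>
         distr M' (borel \<Otimes>\<^sub>M borel)
           (\<lambda>\<omega>. (\<eta> 1 \<omega> + a2 * \<eta> 2 \<omega> + a3 * \<eta> 3 \<omega>, b2 * \<eta> 2 \<omega> + b3 * \<eta> 3 \<omega> + \<eta> 4 \<omega>))
         = distr M (borel \<Otimes>\<^sub>M borel)
           (\<lambda>\<omega>. (\<xi> 1 \<omega> + a2 * \<xi> 2 \<omega> + a3 * \<xi> 3 \<omega>, b2 * \<xi> 2 \<omega> + b3 * \<xi> 3 \<omega> + \<xi> 4 \<omega>))
         \<longrightarrow> (\<exists>\<alpha> :: nat \<Rightarrow> 'a. \<forall>j\<in>{1, 2, 3, 4}.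
                distr M' borel (\<eta> j) = distr M borel (\<lambda>\<omega>. \<xi> j \<omega> + \<alpha> j))))"
proof -
  interpret padic_field p N using assms(1,2) by unfold_locales
  \<comment> \<open>Parts (I) and (II) are the two alternatives of the last hypothesis of this
    lemma.\<close>
  note shift = distr_eq_shift_of_pair_law_eq[OF assms(3-6) assms(7-9), unfolded pair_law_def]
  show ?thesis
    by (intro conjI impI allI; elim conjE; rule shift) auto
qed

end
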